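(* Let $(L,\leqslant)$ be a poset. The following are equivalent: (1) $L$ is an sL-domain; (2) there exists an sL-approximation space $(U,R,\mathcal F)$ such that $(L,\leqslant)$ is order-isomorphic to $(\mathfrak C(U,R,\mathcal F),\subseteq)$.
   Context: Upper approximation: for a set $U$, a binary relation $R$ on $U$ and $A\subseteq U$, put $\overline R(A)=\{x\in U\mid \exists y\in A,\ xRy\}$. $K\subseteq_{fin}X$ means that $K$ is a finite (possibly empty) subset of $X$, and $\mathcal P_{fin}(U)$ is the set of all finite subsets of $U$. CF-approximation space: a triple $(U,R,\mathcal F)$ with $R$ a transitive relation on the set $U$ and $\emptyset\neq\mathcal F\subseteq\mathcal P_{fin}(U)$ such that for every $F\in\mathcal F$ and every $K\subseteq_{fin}\overline R(F)$ there is $G\in\mathcal F$ with $K\subseteq\overline R(G)$ and $G\subseteq\overline R(F)$. CF-closed set: $E\subseteq U$ such that for every $K\subseteq_{fin}E$ there is $F\in\mathcal F$ with $K\subseteq\overline R(F)\subseteq E$ and $F\subseteq E$. $\mathfrak C(U,R,\mathcal F)$ is the set of all CF-closed sets. Join saturation: $\mathcal F^{\sharp}$ is the set of all unions $\bigcup\mathcal A$ of nonempty finite subfamilies $\mathcal A\subseteq\mathcal F$. sL-approximation space: a CF-approximation space $(U,R,\mathcal F)$ such that for all $M\in\mathcal F^{\sharp}$ and $F\in\mathcal F$ with $M\subseteq\overline R(F)$ there is $G\in\mathcal F$ satisfying: (sL-1) $\overline R(M)\subseteq\overline R(G)\subseteq\overline R(F)$; and (sL-2) for all $G'\in\mathcal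 F$, $\overline R(M)\subseteq\overline R(G')\subseteq\overline R(F)$ implies $\overline R(G)\subseteq\overline R(G')$. Domains: directed sets are nonempty; a dcpo is a poset in which every directed subset has a supremum. $x\ll y$ means that for every directed $D$ having a supremum with $\sup D\geqslant y$ there is $d\in D$ with $x\leqslant d$. A continuous domain is a dcpo in which, for every $x$, the set $\{y\mid y\ll x\}$ is directed with supremum $x$. A sup-semilattice is a poset in which every pair of elements has a supremum. An sL-domain is a continuous domain $L$ such that for every $x\in L$ the principal ideal ${\downarrow}x=\{y\in L\mid y\leqslant x\}$, with the inherited order, is a sup-semilattice.
   Formalization: The poset L is assumed nonempty: the empty poset is vacuously an sL-domain, but the set of CF-closed sets is never empty, so (1) would hold and (2) fail for it. *)

theory Defs
  imports "HOL-Library.Lub_Glb"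
begin

text \<open>
  A poset is a set \<open>A\<close> of elements of a type of class \<^class>\<open>order\<close>, with the inherited order.
  Suprema are always taken relative to the carrier: \<open>isLub A S s\<close> says that \<open>s \<in> A\<close> is the least
  among the upper bounds of \<open>S\<close> that lie in \<open>A\<close>.
\<close>

definition directed :: "'a::order set \<Rightarrow> bool" where
  "directed D \<longleftrightarrow> D \<noteq> {} \<and> (\<forall>x\<in>D. \<forall>y\<in>D. \<exists>z\<in>D. x \<le> z \<and> y \<le> z)"

definition dcpo :: "'a::order set \<Rightarrow> bool" where
  "dcpo A \<longleftrightarrow> (\<forall>D. D \<subseteq> A \<and> directed D \<longrightarrow> (\<exists>s. isLub A D s))"

definition way_below :: "'a::order set \<Rightarrow> 'a \<Rightarrow> 'a \<Rightarrow> bool" where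
  "way_below A x y \<longleftrightarrow> x \<in> A \<and> y \<in> A \<and>
     (\<forall>D s. D \<subseteq> A \<and> directed D \<and> isLub A D s \<and> y \<le> s \<longrightarrow> (\<exists>d\<in>D. x \<le> d))"

definition continuous_domain :: "'a::order set \<Rightarrow> bool" where
  "continuous_domain A \<longleftrightarrow> dcpo A \<and>
     (\<forall>x\<in>A. directed {y. way_below A y x} \<and> isLub A {y. way_below A y x} x)"

definition sup_semilattice :: "'a::order set \<Rightarrow> bool" where
  "sup_semilattice A \<longleftrightarrow> (\<forall>x\<in>A. \<forall>y\<in>A. \<exists>s. isLub A {x, y} s)"

definition sL_domain :: "'a::order set \<Rightarrow> bool" where
  "sL_domain A \<longleftrightarrow> continuous_domain A \<and> (\<forall>x\<in>A. sup_semilattice {y \<in> A. y \<le> x})"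

definition order_isomorphic :: "'a::order set \<Rightarrow> 'b::order set \<Rightarrow> bool" where
  "order_isomorphic A B \<longleftrightarrow>
     (\<exists>f. bij_betw f A B \<and> (\<forall>x\<in>A. \<forall>y\<in>A. x \<le> y \<longleftrightarrow> f x \<le> f y))"

definition upper_approx :: "'u set \<Rightarrow> ('u \<times> 'u) set \<Rightarrow> 'u set \<Rightarrow> 'u set" where
  "upper_approx U R A = {x \<in> U. \<exists>y\<in>A. (x, y) \<in> R}"

definition CF_approx_space :: "'u set \<Rightarrow> ('u \<times> 'u) set \<Rightarrow> 'u set set \<Rightarrow> bool" where
  "CF_approx_space U R \<F> \<longleftrightarrow>
     R \<subseteq> U \<times> U \<and> trans R \<and>
     \<F> \<noteq> {} \<and> (\<forall>F\<in>\<F>. finite F \<and> F \<subseteq> U) \<and>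
     (\<forall>F\<in>\<F>. \<forall>K. finite K \<and> K \<subseteq> upper_approx U R F \<longrightarrow>
        (\<exists>G\<in>\<F>. K \<subseteq> upper_approx U R G \<and> G \<subseteq> upper_approx U R F))"

definition CF_closed :: "'u set \<Rightarrow> ('u \<times> 'u) set \<Rightarrow> 'u set set \<Rightarrow> 'u set \<Rightarrow> bool" where
  "CF_closed U R \<F> E \<longleftrightarrow> E \<subseteq> U \<and>
     (\<forall>K. finite K \<and> K \<subseteq> E \<longrightarrow>
        (\<exists>F\<in>\<F>. K \<subseteq> upper_approx U R F \<and> upper_approx U R F \<subseteq> E \<and> F \<subseteq> E))"

definition CF_closed_sets :: "'u set \<Rightarrow> ('u \<times> 'u) set \<Rightarrow> 'u set set \<Rightarrow> 'u set set" where
  "CF_closed_sets U R \<F> = {E. CF_closed U R \<F> E}"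

definition join_saturation :: "'u set set \<Rightarrow> 'u set set" where
  "join_saturation \<F> = {\<Union>\<A> | \<A>. finite \<A> \<and> \<A> \<noteq> {} \<and> \<A> \<subseteq> \<F>}"

definition sL_approx_space :: "'u set \<Rightarrow> ('u \<times> 'u) set \<Rightarrow> 'u set set \<Rightarrow> bool" where
  "sL_approx_space U R \<F> \<longleftrightarrow> CF_approx_space U R \<F> \<and>
     (\<forall>M\<in>join_saturation \<F>. \<forall>F\<in>\<F>. M \<subseteq> upper_approx U R F \<longrightarrow>
        (\<exists>G\<in>\<F>.
           upper_approx U R M \<subseteq> upper_approx U R G \<and>
           upper_approx U R G \<subseteq> upper_approx U R F \<and>
           (\<forall>G'\<in>\<F>. upper_approx U R M \<subseteq> upper_approx U R G' \<and>
                    upper_approx U R G' \<subseteq> upper_approx U R F \<longrightarrow>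
                    upper_approx U R G \<subseteq> upper_approx U R G')))"

end

theory Submission
  imports Defs
begin

text \<open>
  An sL-domain is represented by taking the carrier itself as \<open>U\<close>, the way-below relation as \<open>R\<close> and
  the singletons as \<open>\<F>\<close>: then the CF-closed sets are the rounded ideals \<open>{y. y \<lless> x}\<close>, and
  \<open>G = {g}\<close> in (sL-1), (sL-2) is given by the supremum \<open>g\<close> of \<open>M\<close> in a principal ideal.
  Conversely, each CF-closed set \<open>E\<close> is the directed union of the sets \<open>upper_approx U R F\<close> with
  \<open>F \<in> \<F>\<close>, \<open>F \<subseteq> E\<close>, which are way below \<open>E\<close>.
  The set \<open>G\<close> chosen for \<open>M\<close> below \<open>F\<close> does, up to \<open>upper_approx\<close>, not depend on \<open>F\<close> as long as \<open>F\<close>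
  stays inside a fixed CF-closed set \<open>X\<close>, so the join of \<open>E1\<close> and \<open>E2\<close> below \<open>X\<close> is the directed
  union of the approximations \<open>G\<close> for \<open>M = F1 \<union> F2\<close> with \<open>F1 \<subseteq> E1\<close>, \<open>F2 \<subseteq> E2\<close>.
\<close>

section \<open>Suprema relative to a carrier\<close>

lemma isLub_iff:
  fixes A :: "'a::order set"
  shows "isLub A S s \<longleftrightarrow>
    s \<in> A \<and> (\<forall>x\<in>S. x \<le> s) \<and> (\<forall>t\<in>A. (\<forall>x\<in>S. x \<le> t) \<longrightarrow> s \<le> t)"
  by (auto simp: isLub_def isUb_def leastP_def setle_def setge_def)

lemma isLub_order_unique:
  fixes A :: "'a::order set"
  assumes "isLub A S s" "isLub A S t"
  shows "s = t"
  using assms by (intro order_antisym) (simp_all add: isLub_iff)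

lemma isLub_Un:
  fixes A :: "'a::order set"
  assumes s: "isLub A S s" and t: "isLub A T t" and r: "isLub A {s, t} r"
  shows "isLub A (S \<union> T) r"
proof -
  have "r \<in> A" "s \<le> r" "t \<le> r" "\<forall>x\<in>S. x \<le> s" "\<forall>x\<in>T. x \<le> t"
    using assms by (auto simp: isLub_iff)
  moreover have "r \<le> u" if "u \<in> A" "\<forall>x\<in>S \<union> T. x \<le> u" for u
  proof -
    have "s \<le> u" "t \<le> u"
      using s t that by (auto simp: isLub_iff)
    then show ?thesis
      using r that(1) by (auto simp: isLub_iff)
  qed
  ultimately show ?thesis
    unfolding isLub_iff by (metis Un_iff order_trans)
qed

text \<open>Induction on \<open>M\<close>, adding one element at a time by \<open>isLub_Un\<close>.
  It starts from a singleton because a sup-semilattice need not have a least element to serve as the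
  supremum of the empty set.\<close>

lemma sup_semilattice_finite:
  fixes A :: "'a::order set"
  assumes A: "sup_semilattice A" and "finite M" "M \<noteq> {}" "M \<subseteq> A"
  shows "\<exists>s. isLub A M s"
  using assms(2-)
proof (induction rule: finite_ne_induct)
  case (singleton x)
  then show ?case by (auto simp: isLub_iff)
next
  case (insert x F)
  then obtain s where s: "isLub A F s" by auto
  moreover have "isLub A {x} x"
    using insert.prems by (auto simp: isLub_iff)
  moreover obtain r where "isLub A {x, s} r"
  proof -
    have "x \<in> A" "s \<in> A"
      using insert.prems s by (auto simp: isLub_iff)
    then show thesis
      using A that unfolding sup_semilattice_def by blast
  qed
  ultimately have "isLub A ({x} \<union> F) r" by (blast intro: isLub_Un)
  then show ?case by auto
qed

text \<open>The members of \<open>K\<close> need not lie in \<open>D\<close>. For empty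
  \<open>K\<close> the claim is the nonemptiness built into \<open>directed\<close>; this case does
  occur, since CF-closedness also speaks of empty \<open>K\<close>.\<close>

lemma directed_finite_upper_bound:
  assumes D: "directed D" and "finite K" and "\<forall>k\<in>K. \<exists>d\<in>D. k \<le> d"
  shows "\<exists>d\<in>D. \<forall>k\<in>K. k \<le> d"
  using assms(2,3)
proof (induction rule: finite_induct)
  case empty
  then show ?case using D by (auto simp: directed_def)
next
  case (insert x F)
  then obtain d e where "d \<in> D" "\<forall>k\<in>F. k \<le> d" "e \<in> D" "x \<le> e" by auto
  moreover then obtain z where "z \<in> D" "d \<le> z" "e \<le> z"
    using D unfolding directed_def by blast
  ultimately show ?case by (metis insert_iff order_trans)
qed

text \<open>All quantifiers are bounded by \<open>A\<close> and the implications curried, so that a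
  bijection can be pushed through them by rewriting.\<close>

lemma way_below_iff_carrier:
  "way_below A x y \<longleftrightarrow> x \<in> A \<and> y \<in> A \<and>
    (\<forall>D. D \<subseteq> A \<longrightarrow> directed D \<longrightarrow> (\<forall>s\<in>A. isLub A D s \<longrightarrow> y \<le> s \<longrightarrow> (\<exists>d\<in>D. x \<le> d)))"
proof -
  have "s \<in> A" if "isLub A D s" for D s
    using that by (simp add: isLub_iff)
  then show ?thesis
    unfolding way_below_def by blast
qed

section \<open>Invariance under order isomorphism\<close>

text \<open>A locale, because the transport results are also applied to the inverse of an
  isomorphism and to its restrictions to principal ideals.\<close>

locale order_iso =
  fixes f :: "'a::order \<Rightarrow> 'b::order" and A B
  assumes bij: "bij_betw f A B"
    and le_iff: "\<lbrakk>x \<in> A; y \<in> A\<rbrakk> \<Longrightarrow> f x \<le> f y \<longleftrightarrow> x \<le> y"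
begin

lemma image: "f ` A = B"
  using bij by (rule bij_betw_imp_surj_on)

lemma mem: "x \<in> A \<Longrightarrow> f x \<in> B"
  using image by blast

lemma directed_image: "S \<subseteq> A \<Longrightarrow> directed (f ` S) \<longleftrightarrow> directed S"
  unfolding directed_def by (simp add: subset_iff le_iff)

lemma isLub_image:
  assumes "S \<subseteq> A" "s \<in> A"
  shows "isLub B (f ` S) (f s) \<longleftrightarrow> isLub A S s"
proof -
  have "(\<forall>x\<in>S. f x \<le> f t) \<longleftrightarrow> (\<forall>x\<in>S. x \<le> t)" if "t \<in> A" for t
    using assms(1) le_iff that by blast
  then show ?thesis
    using assms(2) by (simp add: isLub_iff image[symmetric] le_iff)
qed

lemma ex_isLub_image:
  assumes "S \<subseteq> A"
  shows "(\<exists>t. isLub B (f ` S) t) \<longleftrightarrow> (\<exists>s. isLub A S s)"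
proof -
  have "t \<in> f ` A" if "isLub B D t" for D t
    using that by (simp add: isLub_iff image)
  moreover have "s \<in> A" if "isLub A D s" for D s
    using that by (simp add: isLub_iff)
  ultimately show ?thesis
    using isLub_image[OF assms] by blast
qed

text \<open>Every subset of \<open>B\<close> is the image of a subset of \<open>A\<close>, so
  quantifiers over sets pull back along \<open>f\<close> just as quantifiers over points do.\<close>

lemma all_subset: "(\<forall>D. D \<subseteq> B \<longrightarrow> P D) \<longleftrightarrow> (\<forall>D. D \<subseteq> A \<longrightarrow> P (f ` D))"
  using image by (metis subset_image_iff)

lemma way_below_image:
  assumes "x \<in> A" "y \<in> A"
  shows "way_below B (f x) (f y) \<longleftrightarrow> way_below A x y"
proof -
  have *: "(\<forall>s\<in>B. isLub B (f ` D) s \<longrightarrow> f y \<le> s \<longrightarrow> (\<exists>d\<in>f ` D. f x \<le> d)) \<longleftrightarrow>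
      (\<forall>s\<in>A. isLub A D s \<longrightarrow> y \<le> s \<longrightarrow> (\<exists>d\<in>D. x \<le> d))" if D: "D \<subseteq> A" for D
  proof -
    have "(\<exists>d\<in>f ` D. f x \<le> d) \<longleftrightarrow> (\<exists>d\<in>D. x \<le> d)"
      using assms(1) D le_iff by blast
    moreover have "(\<forall>s\<in>B. P s) \<longleftrightarrow> (\<forall>s\<in>A. P (f s))" for P
      using image by blast
    ultimately show ?thesis
      using assms(2) D by (simp add: isLub_image le_iff)
  qed
  have "way_below B (f x) (f y) \<longleftrightarrow>
    (\<forall>D. D \<subseteq> B \<longrightarrow> directed D \<longrightarrow> (\<forall>s\<in>B. isLub B D s \<longrightarrow> f y \<le> s \<longrightarrow> (\<exists>d\<in>D. f x \<le> d)))"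
    using mem assms by (simp add: way_below_iff_carrier)
  also have "\<dots> \<longleftrightarrow>
    (\<forall>D. D \<subseteq> A \<longrightarrow> directed D \<longrightarrow> (\<forall>s\<in>A. isLub A D s \<longrightarrow> y \<le> s \<longrightarrow> (\<exists>d\<in>D. x \<le> d)))"
    unfolding all_subset using * by (simp add: directed_image cong: imp_cong)
  also have "\<dots> \<longleftrightarrow> way_below A x y"
    using assms by (simp add: way_below_iff_carrier)
  finally show ?thesis .
qed

lemma way_below_set_image:
  assumes "x \<in> A"
  shows "{y. way_below B y (f x)} = f ` {y. way_below A y x}"
proof -
  have A: "y \<in> A" if "way_below A y x" for y
    using that by (simp add: way_below_def)
  have "y \<in> f ` A" if "way_below B y (f x)" for y
    using that by (simp add: way_below_def image)
  then have "{y. way_below B y (f x)} = f ` {y \<in> A. way_below B (f y) (f x)}"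
    by blast
  also have "{y \<in> A. way_below B (f y) (f x)} = {y. way_below A y x}"
    using assms A by (auto simp: way_below_image)
  finally show ?thesis .
qed

lemma dcpo_iff: "dcpo B \<longleftrightarrow> dcpo A"
proof -
  have "dcpo B \<longleftrightarrow> (\<forall>D. D \<subseteq> B \<longrightarrow> directed D \<longrightarrow> (\<exists>s. isLub B D s))"
    by (auto simp: dcpo_def)
  also have "\<dots> \<longleftrightarrow> (\<forall>D. D \<subseteq> A \<longrightarrow> directed D \<longrightarrow> (\<exists>s. isLub A D s))"
    unfolding all_subset by (simp add: directed_image ex_isLub_image cong: imp_cong)
  finally show ?thesis by (auto simp: dcpo_def)
qed

lemma continuous_domain_iff: "continuous_domain B \<longleftrightarrow> continuous_domain A"
proof -
  have "{y. way_below A y x} \<subseteq> A" for x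
    by (auto simp: way_below_def)
  \<comment> \<open>Replacing \<open>B\<close> by the image of \<open>A\<close> turns bounded
    quantifiers over \<open>B\<close> into ones over \<open>A\<close>; the transport rules are
    restated with the image in place of \<open>B\<close> so that they still match.\<close>
  then show ?thesis
    unfolding continuous_domain_def dcpo_iff
    by (simp add: image[symmetric] way_below_set_image[unfolded image[symmetric]]
        isLub_image[unfolded image[symmetric]] directed_image)
qed

lemma sup_semilattice_imp: "sup_semilattice B" if "sup_semilattice A"
  unfolding sup_semilattice_def image[symmetric] ball_simps
proof (intro ballI)
  fix x y assume "x \<in> A" "y \<in> A"
  then show "\<exists>s. isLub (f ` A) {f x, f y} s"
    using that ex_isLub_image[of "{x, y}"] by (auto simp: sup_semilattice_def image)
qed

lemma principal_ideal:
  assumes "x \<in> A"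
  shows "order_iso f {y \<in> A. y \<le> x} {y \<in> B. y \<le> f x}"
proof
  have "f ` {y \<in> A. y \<le> x} = {y \<in> B. y \<le> f x}"
    using assms le_iff unfolding image[symmetric] by blast
  moreover have "{y \<in> A. y \<le> x} \<subseteq> A"
    by blast
  ultimately show "bij_betw f {y \<in> A. y \<le> x} {y \<in> B. y \<le> f x}"
    using bij by (blast intro: bij_betw_subset)
qed (auto simp: le_iff)

lemma sL_domain_imp:
  assumes "sL_domain A"
  shows "sL_domain B"
proof -
  have "sup_semilattice {y \<in> B. y \<le> f x}" if "x \<in> A" for x
    using assms that order_iso.sup_semilattice_imp[OF principal_ideal]
    by (simp add: sL_domain_def)
  moreover have "\<exists>x\<in>A. y = f x" if "y \<in> B" for y
    using that image by blast
  ultimately show ?thesis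
    using assms continuous_domain_iff by (auto simp: sL_domain_def)
qed

end

lemma sL_domain_order_isomorphic:
  assumes "order_isomorphic L C" "sL_domain C"
  shows "sL_domain L"
proof -
  obtain f where f: "bij_betw f L C" "\<forall>x\<in>L. \<forall>y\<in>L. x \<le> y \<longleftrightarrow> f x \<le> f y"
    using assms(1) by (auto simp: order_isomorphic_def)
  \<comment> \<open>Transport runs from the source of an isomorphism to its target, but here the
    target \<open>C\<close> carries the hypothesis; hence the inverse.\<close>
  have "order_iso (inv_into L f) C L"
  proof
    show "bij_betw (inv_into L f) C L"
      using f(1) by (rule bij_betw_inv_into)
    fix x y assume "x \<in> C" "y \<in> C"
    then show "inv_into L f x \<le> inv_into L f y \<longleftrightarrow> x \<le> y"
      using f by (metis bij_betw_imp_surj_on f_inv_into_f inv_into_into)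
  qed
  then show ?thesis
    using assms(2) by (rule order_iso.sL_domain_imp)
qed

section \<open>Approximation spaces from sL-domains\<close>

lemma way_below_le:
  assumes "way_below A x y"
  shows "x \<le> y"
proof -
  have "directed {y}" "isLub A {y} y" "{y} \<subseteq> A"
    using assms by (auto simp: directed_def isLub_iff way_below_def)
  then show ?thesis
    using assms unfolding way_below_def by blast
qed

lemma way_below_mono:
  assumes "way_below A x y" "w \<in> A" "z \<in> A" "w \<le> x" "y \<le> z"
  shows "way_below A w z"
  using assms unfolding way_below_def by (meson order_trans)

lemma way_below_mem:
  assumes "way_below A x y"
  shows "x \<in> A" "y \<in> A"
  using assms by (auto simp: way_below_def)

text \<open>Each point is the supremum of the points way below it, so these sets determine the
  order. This makes the representation an order embedding and turns inclusions of approximations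
  into inequalities.\<close>

lemma continuous_domain_le_iff:
  assumes "continuous_domain A" "x \<in> A" "y \<in> A"
  shows "x \<le> y \<longleftrightarrow> {z. way_below A z x} \<subseteq> {z. way_below A z y}"
proof
  show "{z. way_below A z x} \<subseteq> {z. way_below A z y}" if "x \<le> y"
    using that assms(3) way_below_mono way_below_mem(1) by blast
  show "x \<le> y" if sub: "{z. way_below A z x} \<subseteq> {z. way_below A z y}"
  proof -
    have "isLub A {z. way_below A z x} x"
      using assms by (simp add: continuous_domain_def)
    moreover have "z \<le> y" if "way_below A z x" for z
      using sub that way_below_le by blast
    ultimately show ?thesis
      using assms(3) by (simp add: isLub_iff)
  qed
qed

text \<open>The set \<open>D\<close> of points lying two way-below steps under \<open>x\<close> is
  directed with supremum \<open>x\<close>. Hence it contains an upper bound \<open>d\<close> of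
  \<open>K\<close>, and the intermediate point between \<open>d\<close> and \<open>x\<close> is the
  required \<open>z\<close>.\<close>

lemma way_below_interpolation:
  assumes A: "continuous_domain A" and "x \<in> A" and "finite K" and K: "\<forall>k\<in>K. way_below A k x"
  shows "\<exists>z. way_below A z x \<and> (\<forall>k\<in>K. way_below A k z)"
proof -
  define D where "D = {y. \<exists>z. way_below A y z \<and> way_below A z x}"
  have dir: "directed {y. way_below A y z}" and lub: "isLub A {y. way_below A y z} z"
    if "z \<in> A" for z
    using A that by (auto simp: continuous_domain_def)
  have ub: "\<exists>c. way_below A c z \<and> a \<le> c \<and> b \<le> c" if "way_below A a z" "way_below A b z" for a b z
    using dir[of z] way_below_mem that unfolding directed_def by blast
  have "directed D"
    unfolding directed_def
  proof (intro conjI ballI)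
    obtain z where "way_below A z x"
      using dir \<open>x \<in> A\<close> unfolding directed_def by blast
    moreover then obtain y where "way_below A y z"
      using dir[of z] way_below_mem unfolding directed_def by blast
    ultimately show "D \<noteq> {}" by (auto simp: D_def)
  next
    fix a b assume "a \<in> D" "b \<in> D"
    then obtain a' b' where ab: "way_below A a a'" "way_below A a' x" "way_below A b b'" "way_below A b' x"
      by (auto simp: D_def)
    then obtain c where c: "way_below A c x" "a' \<le> c" "b' \<le> c"
      using ub by blast
    then have "way_below A a c" "way_below A b c"
      using ab way_below_mem way_below_mono by blast+
    then obtain d where "way_below A d c" "a \<le> d" "b \<le> d"
      using ub by blast
    then show "\<exists>d\<in>D. a \<le> d \<and> b \<le> d"
      using c by (auto simp: D_def)
  qed
  moreover have "D \<subseteq> A"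
    using way_below_mem by (auto simp: D_def)
  moreover have "isLub A D x"
    unfolding isLub_iff
  proof (intro conjI ballI impI)
    show "y \<le> x" if "y \<in> D" for y
      using that unfolding D_def by (blast intro: way_below_le order_trans)
    show "x \<le> t" if "t \<in> A" "\<forall>y\<in>D. y \<le> t" for t
    proof -
      have "z \<le> t" if z: "way_below A z x" for z
      proof -
        have "\<forall>y\<in>{y. way_below A y z}. y \<le> t"
          using \<open>\<forall>y\<in>D. y \<le> t\<close> z unfolding D_def by blast
        then show ?thesis
          using lub[OF way_below_mem(1)[OF z]] \<open>t \<in> A\<close> by (simp add: isLub_iff)
      qed
      then show ?thesis
        using lub[OF \<open>x \<in> A\<close>] \<open>t \<in> A\<close> by (auto simp: isLub_iff)
    qed
  qed fact
  ultimately have "\<forall>k\<in>K. \<exists>d\<in>D. k \<le> d"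
    using K unfolding way_below_def by blast
  then obtain d where d: "d \<in> D" "\<forall>k\<in>K. k \<le> d"
    using directed_finite_upper_bound \<open>directed D\<close> \<open>finite K\<close> by blast
  then obtain z where "way_below A d z" "way_below A z x"
    by (auto simp: D_def)
  then show ?thesis
    using d(2) K way_below_mem way_below_mono by blast
qed

lemma sL_domain_representation:
  fixes L :: "'a::order set"
  assumes L: "sL_domain L" and "L \<noteq> {}"
  defines "R \<equiv> {(x, y). way_below L x y}" and "\<F> \<equiv> (\<lambda>x. {x}) ` L"
  shows "sL_approx_space L R \<F>" and "order_isomorphic L (CF_closed_sets L R \<F>)"
proof -
  let ?d = "\<lambda>x. {y. way_below L y x}"
  have cont: "continuous_domain L" and sup: "\<And>x. x \<in> L \<Longrightarrow> sup_semilattice {y \<in> L. y \<le> x}"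
    using L by (auto simp: sL_domain_def)
  have up: "upper_approx L R M = (\<Union>x\<in>M. ?d x)" for M
    using way_below_mem by (auto simp: upper_approx_def R_def)
  have trans: "way_below L a c" if "way_below L a b" "way_below L b c" for a b c
    using that way_below_mem way_below_le way_below_mono by (metis order_refl)
  note interpolation = way_below_interpolation[OF cont]
  have "CF_approx_space L R \<F>"
    unfolding CF_approx_space_def
  proof (intro conjI ballI allI impI)
    \<comment> \<open>For a singleton \<open>F\<close> the approximation axiom is exactly
      interpolation, with \<open>G\<close> the singleton of the interpolating point.\<close>
    fix F K assume "F \<in> \<F>" "finite K \<and> K \<subseteq> upper_approx L R F"
    then obtain x where "x \<in> L" "F = {x}" "finite K" "\<forall>k\<in>K. way_below L k x"
      by (auto simp: \<F>_def up)
    moreover then obtain z where z: "way_below L z x" "\<forall>k\<in>K. way_below L k z"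
      using interpolation by blast
    moreover have "z \<in> L"
      using z(1) by (rule way_below_mem)
    ultimately show "\<exists>G\<in>\<F>. K \<subseteq> upper_approx L R G \<and> G \<subseteq> upper_approx L R F"
      by (intro bexI[of _ "{z}"]) (auto simp: up \<F>_def)
  qed (use \<open>L \<noteq> {}\<close> way_below_mem in \<open>auto simp: \<F>_def R_def intro: transI trans\<close>)
  moreover have "\<exists>G\<in>\<F>. upper_approx L R M \<subseteq> upper_approx L R G \<and>
           upper_approx L R G \<subseteq> upper_approx L R F \<and>
           (\<forall>G'\<in>\<F>. upper_approx L R M \<subseteq> upper_approx L R G' \<and>
                    upper_approx L R G' \<subseteq> upper_approx L R F \<longrightarrow>
                    upper_approx L R G \<subseteq> upper_approx L R G')"
    if M: "M \<in> join_saturation \<F>" and F: "F \<in> \<F>" and MF: "M \<subseteq> upper_approx L R F" for M F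
  proof -
    obtain x where x: "x \<in> L" "F = {x}"
      using F by (auto simp: \<F>_def)
    obtain \<A> where \<A>: "M = \<Union>\<A>" "finite \<A>" "\<A> \<noteq> {}" "\<A> \<subseteq> \<F>"
      using M by (auto simp: join_saturation_def)
    have Mfin: "finite M" "M \<noteq> {}"
      using \<A> by (auto simp: \<F>_def)
    have Mx: "M \<subseteq> {y \<in> L. y \<le> x}"
      \<comment> \<open>Being way below \<open>x\<close>, the points of \<open>M\<close> lie in the
        principal ideal of \<open>x\<close>, where finite nonempty sets have suprema.\<close>
      using MF x way_below_mem way_below_le unfolding up by blast
    then obtain g where g: "isLub {y \<in> L. y \<le> x} M g"
      using sup_semilattice_finite[OF sup] x(1) Mfin by blast
    then have gL: "g \<in> L" "g \<le> x" "\<forall>m\<in>M. m \<le> g"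
      by (auto simp: isLub_iff)
    have "M \<subseteq> L" using Mx by auto
    have le: "(\<Union>m\<in>M. ?d m) \<subseteq> ?d h \<longleftrightarrow> (\<forall>m\<in>M. m \<le> h)" if "h \<in> L" for h
      using continuous_domain_le_iff[OF cont _ that] \<open>M \<subseteq> L\<close> by blast
    \<comment> \<open>The inclusion in \<open>?d x\<close> places \<open>h\<close> in the principal
      ideal of \<open>x\<close>, the only place where \<open>g\<close> is known to be least among
      the upper bounds of \<open>M\<close>.\<close>
    have g_least: "?d g \<subseteq> ?d h"
      if "h \<in> L" "(\<Union>m\<in>M. ?d m) \<subseteq> ?d h" "?d h \<subseteq> ?d x" for h
    proof -
      have "\<forall>m\<in>M. m \<le> h" "h \<le> x"
        using that le x(1) continuous_domain_le_iff[OF cont] by auto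
      then have "g \<le> h"
        using g \<open>h \<in> L\<close> by (auto simp: isLub_iff)
      then show ?thesis
        using continuous_domain_le_iff[OF cont] gL \<open>h \<in> L\<close> by blast
    qed
    show ?thesis
    proof (rule bexI[of _ "{g}"], intro conjI ballI impI)
      show "upper_approx L R M \<subseteq> upper_approx L R {g}"
        using le gL unfolding up by blast
      show "upper_approx L R {g} \<subseteq> upper_approx L R F"
        using continuous_domain_le_iff[OF cont] gL x unfolding up by blast
    next
      fix G' assume "G' \<in> \<F>"
        and G': "upper_approx L R M \<subseteq> upper_approx L R G' \<and> upper_approx L R G' \<subseteq> upper_approx L R F"
      then obtain h where h: "h \<in> L" "G' = {h}"
        by (auto simp: \<F>_def)
      then show "upper_approx L R {g} \<subseteq> upper_approx L R G'"
        using g_least[of h] G' x(2) by (simp add: up)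
    next
      show "{g} \<in> \<F>"
        using gL by (simp add: \<F>_def)
    qed
  qed
  ultimately show "sL_approx_space L R \<F>"
    by (simp add: sL_approx_space_def)

  have closed_iff: "CF_closed L R \<F> E \<longleftrightarrow>
    E \<subseteq> L \<and> (\<forall>K. finite K \<and> K \<subseteq> E \<longrightarrow> (\<exists>x\<in>E. K \<subseteq> ?d x \<and> ?d x \<subseteq> E))" for E
  proof -
    have "(\<exists>F\<in>\<F>. K \<subseteq> upper_approx L R F \<and> upper_approx L R F \<subseteq> E \<and> F \<subseteq> E) \<longleftrightarrow>
        (\<exists>x\<in>E. K \<subseteq> ?d x \<and> ?d x \<subseteq> E)" if "E \<subseteq> L" for K
      using that by (simp add: \<F>_def up bex_simps) blast
    then show ?thesis
      unfolding CF_closed_def by (simp cong: conj_cong)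
  qed
  have "?d ` L = CF_closed_sets L R \<F>"
  proof (intro equalityI subsetI)
    fix E assume "E \<in> ?d ` L"
    then obtain x where x: "x \<in> L" "E = ?d x" by blast
    have "\<exists>z\<in>?d x. K \<subseteq> ?d z \<and> ?d z \<subseteq> ?d x" if K: "finite K \<and> K \<subseteq> ?d x" for K
    proof -
      obtain z where "way_below L z x" "\<forall>k\<in>K. way_below L k z"
        using interpolation[OF x(1), of K] K by blast
      then show ?thesis using trans by blast
    qed
    moreover have "?d x \<subseteq> L" using way_below_mem by blast
    ultimately show "E \<in> CF_closed_sets L R \<F>"
      unfolding CF_closed_sets_def closed_iff x(2) by blast
  next
    fix E assume "E \<in> CF_closed_sets L R \<F>"
    then have EL: "E \<subseteq> L" and E: "\<And>K. finite K \<Longrightarrow> K \<subseteq> E \<Longrightarrow> \<exists>x\<in>E. K \<subseteq> ?d x \<and> ?d x \<subseteq> E"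
      by (auto simp: CF_closed_sets_def closed_iff)
    \<comment> \<open>Closedness for the empty set yields a point of \<open>E\<close>, and for a
      pair it yields a common upper bound.\<close>
    have "directed E"
      unfolding directed_def
    proof (intro conjI ballI)
      show "E \<noteq> {}" using E[of "{}"] by auto
      fix a b assume "a \<in> E" "b \<in> E"
      then show "\<exists>c\<in>E. a \<le> c \<and> b \<le> c"
        using E[of "{a, b}"] way_below_le by auto
    qed
    then obtain s where s: "isLub L E s"
      using cont EL by (auto simp: continuous_domain_def dcpo_def)
    then have "s \<in> L" by (simp add: isLub_iff)
    have "E = ?d s"
    proof (intro equalityI subsetI)
      fix e assume "e \<in> E"
      then obtain g where "g \<in> E" "way_below L e g"
        using E[of "{e}"] by auto
      moreover have "g \<le> s"
        using s \<open>g \<in> E\<close> by (simp add: isLub_iff)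
      ultimately show "e \<in> ?d s"
        using way_below_mono[of L e g e s] way_below_mem(1) \<open>s \<in> L\<close> by blast
    next
      \<comment> \<open>Closedness does not directly say that \<open>E\<close> is a lower set. One
        further step from \<open>e\<close> to some \<open>g\<close> with \<open>e\<close> way below
        \<open>g\<close> puts \<open>y\<close> into \<open>?d g\<close>, which is contained in
        \<open>E\<close>.\<close>
      fix y assume y: "y \<in> ?d s"
      then obtain e where "e \<in> E" "y \<le> e"
        using s \<open>directed E\<close> EL unfolding way_below_def by blast
      moreover then obtain g where "g \<in> E" "way_below L e g" "?d g \<subseteq> E"
        using E[of "{e}"] by auto
      ultimately show "y \<in> E"
        using way_below_mono y way_below_mem by blast
    qed
    then show "E \<in> ?d ` L" using \<open>s \<in> L\<close> by blast
  qed
  moreover have "inj_on ?d L"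
    using continuous_domain_le_iff[OF cont] by (intro inj_onI order_antisym) auto
  ultimately show "order_isomorphic L (CF_closed_sets L R \<F>)"
    unfolding order_isomorphic_def bij_betw_def
    using continuous_domain_le_iff[OF cont] by blast
qed

section \<open>Sets closed in a CF-approximation space\<close>

locale CF_space =
  fixes U :: "'u set" and R \<F>
  assumes CF: "CF_approx_space U R \<F>"
begin

abbreviation up where "up \<equiv> upper_approx U R"
abbreviation C where "C \<equiv> CF_closed_sets U R \<F>"

lemma finite_mem: "F \<in> \<F> \<Longrightarrow> finite F"
  using CF by (simp add: CF_approx_space_def)

lemma up_Un: "up (A \<union> B) = up A \<union> up B"
  by (auto simp: upper_approx_def)

lemma up_subset: "A \<subseteq> up B \<Longrightarrow> up A \<subseteq> up B"
proof -
  have "trans R"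
    using CF by (simp add: CF_approx_space_def)
  then show "up A \<subseteq> up B" if "A \<subseteq> up B"
    using that unfolding upper_approx_def by (blast dest: transD)
qed

lemma closed_approx:
  assumes "E \<in> C" "finite K" "K \<subseteq> E"
  shows "\<exists>F\<in>\<F>. K \<subseteq> up F \<and> up F \<subseteq> E \<and> F \<subseteq> E"
  using assms by (simp add: CF_closed_sets_def CF_closed_def)

text \<open>The definition of closedness promises such an inclusion only for some member of
  \<open>\<F>\<close>. As \<open>F\<close> is finite, that member \<open>G\<close> can be chosen
  with \<open>F \<subseteq> up G\<close>, and transitivity of \<open>R\<close> does the
  rest.\<close>

lemma up_subset_closed:
  assumes "E \<in> C" "F \<in> \<F>" "F \<subseteq> E"
  shows "up F \<subseteq> E"
proof -
  obtain G where "F \<subseteq> up G" "up G \<subseteq> E"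
    using closed_approx[OF assms(1) finite_mem[OF assms(2)] assms(3)] by blast
  then show ?thesis
    using up_subset by blast
qed

text \<open>The approximation axiom supplies \<open>G\<close>; the inclusion
  \<open>up G \<subseteq> up F\<close>, which closedness also demands, comes from transitivity of
  \<open>R\<close>.\<close>

lemma up_closed:
  assumes "F \<in> \<F>"
  shows "up F \<in> C"
proof -
  have "\<exists>G\<in>\<F>. K \<subseteq> up G \<and> up G \<subseteq> up F \<and> G \<subseteq> up F" if "finite K" "K \<subseteq> up F" for K
  proof -
    have "\<exists>G\<in>\<F>. K \<subseteq> up G \<and> G \<subseteq> up F"
      using CF assms that by (simp add: CF_approx_space_def)
    then show ?thesis
      using up_subset by blast
  qed
  moreover have "up F \<subseteq> U" by (auto simp: upper_approx_def)
  ultimately show ?thesis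
    by (simp add: CF_closed_sets_def CF_closed_def)
qed

section \<open>Directed unions and the way-below relation between closed sets\<close>

lemma finite_subset_directed_Union:
  fixes D :: "'u set set"
  assumes "directed D" "finite K" "K \<subseteq> \<Union>D"
  shows "\<exists>E\<in>D. K \<subseteq> E"
proof -
  have "directed D" "finite ((\<lambda>k. {k}) ` K)" "\<forall>S\<in>(\<lambda>k. {k}) ` K. \<exists>E\<in>D. S \<subseteq> E"
    using assms by auto
  then have "\<exists>E\<in>D. \<forall>S\<in>(\<lambda>k. {k}) ` K. S \<subseteq> E"
    by (rule directed_finite_upper_bound)
  then show ?thesis by auto
qed

lemma directed_Union_closed:
  assumes "D \<subseteq> C" "directed D"
  shows "\<Union>D \<in> C"
proof -
  have "\<exists>F\<in>\<F>. K \<subseteq> up F \<and> up F \<subseteq> \<Union>D \<and> F \<subseteq> \<Union>D" if K: "finite K" "K \<subseteq> \<Union>D" for K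
  proof -
    obtain E where "E \<in> D" "K \<subseteq> E"
      using finite_subset_directed_Union[OF assms(2) K] by blast
    moreover then obtain F where "F \<in> \<F>" "K \<subseteq> up F" "up F \<subseteq> E" "F \<subseteq> E"
      using assms(1) closed_approx[of E K] K(1) by blast
    ultimately show ?thesis by blast
  qed
  moreover have "\<Union>D \<subseteq> U"
    using assms(1) by (auto simp: CF_closed_sets_def CF_closed_def)
  ultimately show ?thesis
    by (simp add: CF_closed_sets_def CF_closed_def)
qed

lemma isLub_directed_Union:
  assumes "D \<subseteq> C" "directed D"
  shows "isLub C D (\<Union>D)"
  using directed_Union_closed[OF assms] by (auto simp: isLub_iff)

lemma isLub_directed_iff:
  assumes "D \<subseteq> C" "directed D"
  shows "isLub C D s \<longleftrightarrow> s = \<Union>D"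
  using isLub_directed_Union[OF assms] isLub_order_unique by blast

text \<open>The union of two finite subsets of \<open>E\<close> is again finite, so closedness
  captures it in a single \<open>up H\<close> with \<open>H \<subseteq> E\<close>.\<close>

lemma directed_up:
  assumes "E \<in> C"
  shows "directed (up ` {F \<in> \<F>. F \<subseteq> E})"
  unfolding directed_def
proof (intro conjI ballI)
  show "up ` {F \<in> \<F>. F \<subseteq> E} \<noteq> {}"
    using closed_approx[OF assms, of "{}"] by blast
  fix A B assume "A \<in> up ` {F \<in> \<F>. F \<subseteq> E}" "B \<in> up ` {F \<in> \<F>. F \<subseteq> E}"
  then obtain F G where FG: "A = up F" "B = up G" "F \<in> \<F>" "G \<in> \<F>" "F \<subseteq> E" "G \<subseteq> E"
    by auto
  then have "finite (F \<union> G)" "F \<union> G \<subseteq> E"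
    using finite_mem by auto
  then obtain H where "H \<in> \<F>" "F \<union> G \<subseteq> up H" "H \<subseteq> E"
    using closed_approx[OF assms] by blast
  then show "\<exists>Z\<in>up ` {F \<in> \<F>. F \<subseteq> E}. A \<subseteq> Z \<and> B \<subseteq> Z"
    using FG up_subset by (intro bexI[of _ "up H"]) auto
qed

lemma Union_up:
  assumes "E \<in> C"
  shows "\<Union>(up ` {F \<in> \<F>. F \<subseteq> E}) = E"
proof (intro equalityI subsetI)
  fix x assume "x \<in> E"
  then show "x \<in> \<Union>(up ` {F \<in> \<F>. F \<subseteq> E})"
    using closed_approx[OF assms, of "{x}"] by auto
qed (use up_subset_closed[OF assms] in blast)

text \<open>From left to right, test with the directed family of all \<open>up F\<close>, whose
  union is \<open>E2\<close>. Conversely, a finite \<open>F\<close> inside a directed union lies in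
  one member \<open>d\<close>, and \<open>up F \<subseteq> d\<close> because \<open>d\<close> is
  closed.\<close>

lemma way_below_iff:
  assumes "E1 \<in> C" "E2 \<in> C"
  shows "way_below C E1 E2 \<longleftrightarrow> (\<exists>F\<in>\<F>. F \<subseteq> E2 \<and> E1 \<subseteq> up F)"
proof
  let ?D = "up ` {F \<in> \<F>. F \<subseteq> E2}"
  assume "way_below C E1 E2"
  moreover have "?D \<subseteq> C" "directed ?D" "isLub C ?D E2"
    using up_closed directed_up[OF assms(2)] Union_up[OF assms(2)]
      isLub_directed_iff[of ?D E2] by auto
  ultimately have "\<exists>d\<in>?D. E1 \<subseteq> d"
    unfolding way_below_def by blast
  then show "\<exists>F\<in>\<F>. F \<subseteq> E2 \<and> E1 \<subseteq> up F" by auto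
next
  assume "\<exists>F\<in>\<F>. F \<subseteq> E2 \<and> E1 \<subseteq> up F"
  then obtain F where F: "F \<in> \<F>" "F \<subseteq> E2" "E1 \<subseteq> up F" by blast
  have "\<exists>d\<in>D. E1 \<subseteq> d" if D: "D \<subseteq> C" "directed D" "E2 \<subseteq> \<Union>D" for D
  proof -
    have "F \<subseteq> \<Union>D"
      using D(3) F(2) by blast
    then obtain d where d: "d \<in> D" "F \<subseteq> d"
      using finite_subset_directed_Union[OF D(2) finite_mem[OF F(1)]] by blast
    then have "up F \<subseteq> d"
      using F(1) D(1) up_subset_closed[of d F] by blast
    then show ?thesis
      using d(1) F(3) by blast
  qed
  then show "way_below C E1 E2"
    using assms isLub_directed_iff by (auto simp: way_below_def)
qed

lemma continuous_domain_closed: "continuous_domain C"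
  unfolding continuous_domain_def
proof (intro conjI ballI)
  show "dcpo C"
    unfolding dcpo_def using isLub_directed_Union by blast
  fix E assume E: "E \<in> C"
  have sub: "{A. way_below C A E} \<subseteq> C"
    by (auto simp: way_below_def)
  have up_wb: "up F \<in> {A. way_below C A E}" if "F \<in> \<F>" "F \<subseteq> E" for F
    using that E up_closed way_below_iff by blast
  have below: "\<exists>F\<in>\<F>. F \<subseteq> E \<and> A \<subseteq> up F" if "way_below C A E" for A
    using that way_below_iff by (auto simp: way_below_def)
  show dir: "directed {A. way_below C A E}"
    unfolding directed_def
  proof (intro conjI ballI)
    show "{A. way_below C A E} \<noteq> {}"
      using closed_approx[OF E, of "{}"] up_wb by blast
    fix A B assume "A \<in> {A. way_below C A E}" "B \<in> {A. way_below C A E}"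
    then obtain F G where FG: "F \<in> \<F>" "F \<subseteq> E" "A \<subseteq> up F" "G \<in> \<F>" "G \<subseteq> E" "B \<subseteq> up G"
      using below[of A] below[of B] by auto
    then obtain H where H: "H \<in> \<F>" "H \<subseteq> E" "up F \<subseteq> up H" "up G \<subseteq> up H"
      using directed_up[OF E] unfolding directed_def by blast
    then have "A \<subseteq> up H \<and> B \<subseteq> up H"
      using FG by blast
    then show "\<exists>Z\<in>{A. way_below C A E}. A \<subseteq> Z \<and> B \<subseteq> Z"
      using up_wb[OF H(1,2)] by (rule bexI)
  qed
  \<comment> \<open>The sets \<open>up F\<close> with \<open>F \<subseteq> E\<close> are way below
    \<open>E\<close> and already cover it, while everything way below \<open>E\<close> is contained
    in \<open>E\<close>.\<close>
  have "\<Union>{A. way_below C A E} = E"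
  proof
    have "up ` {F \<in> \<F>. F \<subseteq> E} \<subseteq> {A. way_below C A E}"
      using up_wb by blast
    then show "E \<subseteq> \<Union>{A. way_below C A E}"
      using Union_mono Union_up[OF E] by metis
    show "\<Union>{A. way_below C A E} \<subseteq> E"
      by (intro Union_least) (simp add: way_below_le)
  qed
  then show "isLub C {A. way_below C A E} E"
    using isLub_directed_iff[OF sub dir] by simp
qed

text \<open>
  (sL-1) only bounds \<open>up G\<close>, not \<open>G\<close> itself; hence smallness inside \<open>X\<close> has to be phrased as
  \<open>up G \<subseteq> up H\<close> for some \<open>H \<subseteq> X\<close> rather than as \<open>G \<subseteq> X\<close>.
\<close>

definition local_join :: "'u set \<Rightarrow> 'u set \<Rightarrow> 'u set \<Rightarrow> bool" where
  "local_join X M G \<longleftrightarrow> G \<in> \<F> \<and> up M \<subseteq> up G \<and> (\<exists>H\<in>\<F>. H \<subseteq> X \<and> up G \<subseteq> up H) \<and>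
    (\<forall>G'\<in>\<F>. up M \<subseteq> up G' \<and> (\<exists>H\<in>\<F>. H \<subseteq> X \<and> up G' \<subseteq> up H) \<longrightarrow> up G \<subseteq> up G')"

text \<open>\<open>G'\<close> is a competitor in the minimality of \<open>G\<close>. For
  \<open>M = M'\<close> this shows that \<open>up G\<close> does not depend on the choice of
  \<open>G\<close>.\<close>

lemma local_join_mono:
  assumes "local_join X M G" "local_join X M' G'" "up M \<subseteq> up M'"
  shows "up G \<subseteq> up G'"
  using assms unfolding local_join_def by (meson order_trans)

end

section \<open>Suprema in principal ideals of closed sets\<close>

locale sL_space = CF_space +
  assumes sL: "sL_approx_space U R \<F>"
begin

lemma sL_approx:
  assumes "M \<in> join_saturation \<F>" "F \<in> \<F>" "M \<subseteq> up F"
  shows "\<exists>G\<in>\<F>. up M \<subseteq> up G \<and> up G \<subseteq> up F \<and>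
    (\<forall>G'\<in>\<F>. up M \<subseteq> up G' \<and> up G' \<subseteq> up F \<longrightarrow> up G \<subseteq> up G')"
  using sL assms by (simp add: sL_approx_space_def)

text \<open>Take \<open>G\<close> minimal relative to one \<open>H\<close>. A competitor bounded by
  another \<open>H1\<close> is compared through the minimal \<open>G2\<close> relative to a common
  bound \<open>H2\<close> of \<open>H\<close> and \<open>H1\<close>.\<close>

lemma ex_local_join:
  assumes X: "X \<in> C" and M: "M \<in> join_saturation \<F>" "finite M" "M \<subseteq> X"
  shows "\<exists>G. local_join X M G"
proof -
  obtain H where H: "H \<in> \<F>" "M \<subseteq> up H" "H \<subseteq> X"
    using closed_approx[OF X M(2,3)] by blast
  obtain G where G: "G \<in> \<F>" "up M \<subseteq> up G" "up G \<subseteq> up H"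
    "\<forall>G'\<in>\<F>. up M \<subseteq> up G' \<and> up G' \<subseteq> up H \<longrightarrow> up G \<subseteq> up G'"
    using sL_approx[OF M(1) H(1,2)] by blast
  have "up G \<subseteq> up G'" if G': "G' \<in> \<F>" "up M \<subseteq> up G'" "H1 \<in> \<F>" "H1 \<subseteq> X" "up G' \<subseteq> up H1" for G' H1
  proof -
    obtain H2 where H2: "H2 \<in> \<F>" "up H \<subseteq> up H2" "up H1 \<subseteq> up H2"
      using directed_up[OF X] H G' unfolding directed_def by blast
    have "M \<subseteq> up H2"
      using H(2) H2(2) by (rule order_trans)
    then obtain G2 where G2: "G2 \<in> \<F>" "up M \<subseteq> up G2" "up G2 \<subseteq> up H2"
      "\<forall>G'\<in>\<F>. up M \<subseteq> up G' \<and> up G' \<subseteq> up H2 \<longrightarrow> up G2 \<subseteq> up G'"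
      using sL_approx[OF M(1) H2(1)] by blast
    have "up G2 \<subseteq> up G'"
      using G2(4) G'(1,2,5) H2(3) by blast
    \<comment> \<open>\<open>H\<close> itself competes with \<open>G2\<close> below
      \<open>H2\<close>; so \<open>G2\<close> is bounded by \<open>H\<close> and in turn competes
      with \<open>G\<close>.\<close>
    moreover have "up G2 \<subseteq> up H"
      using G2(4) H(1) up_subset[OF H(2)] H2(2) by blast
    then have "up G \<subseteq> up G2"
      using G(4) G2(1,2) by blast
    ultimately show ?thesis by blast
  qed
  then show ?thesis
    unfolding local_join_def using G H by blast
qed

lemma sup_semilattice_principal_ideal:
  assumes X: "X \<in> C"
  shows "sup_semilattice {E \<in> C. E \<subseteq> X}"
  unfolding sup_semilattice_def
proof (intro ballI)
  fix E1 E2 assume "E1 \<in> {E \<in> C. E \<subseteq> X}" "E2 \<in> {E \<in> C. E \<subseteq> X}"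
  then have E: "E1 \<in> C" "E1 \<subseteq> X" "E2 \<in> C" "E2 \<subseteq> X" by auto
  \<comment> \<open>A union in \<open>I\<close> need not belong to \<open>\<F>\<close>, so
    \<open>D\<close> replaces it by its local joins in \<open>X\<close>. All local joins of one
    \<open>M\<close> have the same \<open>up\<close>, hence no choice is made.\<close>
  define I where "I = {F1 \<union> F2 | F1 F2. F1 \<in> \<F> \<and> F1 \<subseteq> E1 \<and> F2 \<in> \<F> \<and> F2 \<subseteq> E2}"
  define D where "D = {up G | G M. M \<in> I \<and> local_join X M G}"
  have I_join: "M \<in> join_saturation \<F>" "finite M" "M \<subseteq> E1 \<union> E2" if "M \<in> I" for M
  proof -
    obtain F1 F2 where F: "M = F1 \<union> F2" "F1 \<in> \<F>" "F1 \<subseteq> E1" "F2 \<in> \<F>" "F2 \<subseteq> E2"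
      using \<open>M \<in> I\<close> unfolding I_def by blast
    then have "M = \<Union>{F1, F2}" "finite {F1, F2}" "{F1, F2} \<noteq> {}" "{F1, F2} \<subseteq> \<F>" by auto
    then show "M \<in> join_saturation \<F>"
      unfolding join_saturation_def by blast
    show "finite M" "M \<subseteq> E1 \<union> E2"
      using F finite_mem by auto
  qed
  have ex: "\<exists>G. local_join X M G" if "M \<in> I" for M
    using ex_local_join[OF X] I_join[OF that] E by blast
  have approx: "\<exists>M\<in>I. up F1 \<union> up F2 \<subseteq> up M" if "F1 \<in> \<F>" "F1 \<subseteq> E1" "F2 \<in> \<F>" "F2 \<subseteq> E2" for F1 F2
    using that by (intro bexI[of _ "F1 \<union> F2"]) (auto simp: I_def up_Un)
  have I_directed: "\<exists>M\<in>I. up M1 \<subseteq> up M \<and> up M2 \<subseteq> up M" if M: "M1 \<in> I" "M2 \<in> I" for M1 M2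
  proof -
    obtain F1 F2 where F: "M1 = F1 \<union> F2" "F1 \<in> \<F>" "F1 \<subseteq> E1" "F2 \<in> \<F>" "F2 \<subseteq> E2"
      using M(1) unfolding I_def by blast
    obtain G1 G2 where G: "M2 = G1 \<union> G2" "G1 \<in> \<F>" "G1 \<subseteq> E1" "G2 \<in> \<F>" "G2 \<subseteq> E2"
      using M(2) unfolding I_def by blast
    obtain H1 where "H1 \<in> \<F>" "H1 \<subseteq> E1" "up F1 \<subseteq> up H1" "up G1 \<subseteq> up H1"
      using directed_up[OF E(1)] F G unfolding directed_def by blast
    moreover obtain H2 where "H2 \<in> \<F>" "H2 \<subseteq> E2" "up F2 \<subseteq> up H2" "up G2 \<subseteq> up H2"
      using directed_up[OF E(3)] F G unfolding directed_def by blast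
    ultimately obtain M where "M \<in> I" "up F1 \<union> up F2 \<subseteq> up M" "up G1 \<union> up G2 \<subseteq> up M"
      using approx[of H1 H2] by blast
    then show ?thesis
      unfolding F(1) G(1) up_Un by blast
  qed
  have D_mem: "up G \<in> D" if "M \<in> I" "local_join X M G" for M G
    using that unfolding D_def by blast
  have D_cases: "\<exists>G M. A = up G \<and> M \<in> I \<and> local_join X M G" if "A \<in> D" for A
    using that unfolding D_def by blast
  \<comment> \<open>Some approximation of each side is fixed, to complete an approximation of the
    other side to a member of \<open>I\<close>.\<close>
  obtain F1 where F1: "F1 \<in> \<F>" "F1 \<subseteq> E1"
    using closed_approx[OF E(1), of "{}"] by blast
  obtain F2 where F2: "F2 \<in> \<F>" "F2 \<subseteq> E2"
    using closed_approx[OF E(3), of "{}"] by blast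
  have "D \<subseteq> C"
    using up_closed by (auto simp: D_def local_join_def)
  moreover have "directed D"
    unfolding directed_def
  proof (intro conjI ballI)
    obtain M where "M \<in> I" using approx F1 F2 by blast
    then show "D \<noteq> {}" using ex D_mem by blast
    fix A B assume "A \<in> D" "B \<in> D"
    then obtain M1 G1 M2 G2 where G: "A = up G1" "M1 \<in> I" "local_join X M1 G1"
      "B = up G2" "M2 \<in> I" "local_join X M2 G2"
      using D_cases[of A] D_cases[of B] by blast
    then obtain M where M: "M \<in> I" "up M1 \<subseteq> up M" "up M2 \<subseteq> up M"
      using I_directed by blast
    obtain N where N: "local_join X M N"
      using ex[OF M(1)] by blast
    have "A \<subseteq> up N \<and> B \<subseteq> up N"
      unfolding G(1,4) using local_join_mono[OF G(3) N M(2)] local_join_mono[OF G(6) N M(3)] by simp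
    then show "\<exists>Z\<in>D. A \<subseteq> Z \<and> B \<subseteq> Z"
      using D_mem[OF M(1) N] by (rule bexI)
  qed
  ultimately have closed: "\<Union>D \<in> C"
    by (rule directed_Union_closed)
  have I_sub: "up M \<subseteq> \<Union>D" if M: "M \<in> I" for M
  proof -
    obtain G where G: "local_join X M G"
      using ex[OF M] by blast
    then have "up M \<subseteq> up G"
      by (simp add: local_join_def)
    then show ?thesis
      using D_mem[OF M G] by blast
  qed
  have "isLub {E \<in> C. E \<subseteq> X} {E1, E2} (\<Union>D)"
    unfolding isLub_iff
  proof (intro conjI ballI impI)
    \<comment> \<open>A local join \<open>G\<close> need not lie in \<open>X\<close>, but
      \<open>up G\<close> lies in some \<open>up H\<close> with \<open>H \<subseteq> X\<close>, and
      \<open>up H\<close> stays inside the closed set \<open>X\<close>.\<close>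
    have "\<Union>D \<subseteq> X"
      using up_subset_closed[OF X] by (fastforce simp: D_def local_join_def)
    then show "\<Union>D \<in> {E \<in> C. E \<subseteq> X}" using closed by simp
  next
    fix A assume "A \<in> {E1, E2}"
    moreover have "up F \<subseteq> \<Union>D" if "F \<in> \<F>" "F \<subseteq> E1" for F
      using approx[OF that F2] I_sub by blast
    then have "E1 \<subseteq> \<Union>D"
      by (subst Union_up[OF E(1), symmetric]) blast
    moreover have "up F \<subseteq> \<Union>D" if "F \<in> \<F>" "F \<subseteq> E2" for F
      using approx[OF F1 that] I_sub by blast
    then have "E2 \<subseteq> \<Union>D"
      by (subst Union_up[OF E(3), symmetric]) blast
    ultimately show "A \<subseteq> \<Union>D" by blast
  next
    fix T assume "T \<in> {E \<in> C. E \<subseteq> X}" "\<forall>A\<in>{E1, E2}. A \<subseteq> T"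
    then have T: "T \<in> C" "T \<subseteq> X" "E1 \<subseteq> T" "E2 \<subseteq> T" by auto
    have "up G \<subseteq> T" if G: "M \<in> I" "local_join X M G" for M G
    proof -
      \<comment> \<open>Closedness of \<open>T\<close> provides \<open>H\<close> inside
        \<open>T\<close>, hence inside \<open>X\<close>, with \<open>M \<subseteq> up H\<close>.
        This \<open>H\<close> competes with \<open>G\<close>, which forces \<open>up G\<close> into
        \<open>T\<close>.\<close>
      have "M \<subseteq> T" using I_join(3)[OF G(1)] T by blast
      then obtain H where H: "H \<in> \<F>" "M \<subseteq> up H" "up H \<subseteq> T" "H \<subseteq> T"
        using closed_approx[OF T(1) I_join(2)[OF G(1)]] by blast
      have "up M \<subseteq> up H" "H \<subseteq> X"
        using up_subset[OF H(2)] H(4) T(2) by auto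
      then have "up G \<subseteq> up H"
        using G(2) H(1) unfolding local_join_def by blast
      then show ?thesis
        using H(3) by (rule order_trans)
    qed
    then show "\<Union>D \<subseteq> T"
      using D_cases by (intro Union_least) blast
  qed
  then show "\<exists>s. isLub {E \<in> C. E \<subseteq> X} {E1, E2} s" by blast
qed

end

lemma sL_domain_closed_sets:
  assumes "sL_approx_space U R \<F>"
  shows "sL_domain (CF_closed_sets U R \<F>)"
proof -
  interpret sL_space U R \<F>
    using assms by unfold_locales (simp_all add: sL_approx_space_def)
  show ?thesis
    unfolding sL_domain_def
    using continuous_domain_closed sup_semilattice_principal_ideal by blast
qed

text \<open>Types cannot be quantified inside a formula: the equivalence uses spaces over the
  element type of \<open>L\<close>, and the second conjunct gives the converse over any type. The
  empty poset must be excluded: it satisfies \<open>sL_domain\<close>, whereas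
  \<open>CF_closed_sets U R \<F>\<close> contains \<open>upper_approx U R F\<close> for every
  \<open>F\<close> in the nonempty \<open>\<F>\<close>.\<close>

theorem theorem5p3:
  fixes L :: "'a::order set"
  assumes "L \<noteq> {}"
  shows "(sL_domain L \<longleftrightarrow>
            (\<exists>(U :: 'a set) R \<F>. sL_approx_space U R \<F> \<and>
               order_isomorphic L (CF_closed_sets U R \<F>))) \<and>
         ((\<exists>(U :: 'u set) R \<F>. sL_approx_space U R \<F> \<and>
               order_isomorphic L (CF_closed_sets U R \<F>)) \<longrightarrow> sL_domain L)"
proof (intro conjI impI iffI)
  assume "sL_domain L"
  from sL_domain_representation[OF this assms]
  show "\<exists>(U :: 'a set) R \<F>. sL_approx_space U R \<F> \<and> order_isomorphic L (CF_closed_sets U R \<F>)"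
    by (intro exI conjI)
qed (elim exE conjE, rule sL_domain_order_isomorphic, assumption, erule sL_domain_closed_sets)+

end
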